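(* If the Job Allocation Algorithm terminates, then the output $(X;p,q,r)$ is a pairwise stable outcome. That is, $X$ is a job allocation, $p$ is a feasible salary vector, $q,r$ are the payoff vectors determined by $X$ and $p$, and (ps1) $f_{ij}(p_{ij})\ge 0$ and $f_{ji}(-p_{ij})\ge 0$ for all $(i,j)\in X$; (ps2) for all $(i,j)\in E$ and all $\theta\in\mathbf{Z}$ with $a_{ij}\le\theta\le b_{ij}$: $f_{ij}(\theta)\le q_i$ or $f_{ji}(-\theta)\le r_j$.
   Context: Model. $W$ (workers) and $F$ (firms) are disjoint finite sets, and $E$ is the set of all worker-firm pairs $(i,j)$, $i\in W$, $j\in F$. Each firm $j$ has a quota $\mu(j)$, a positive integer. Integer vectors $a,b\in\mathbf{Z}^E$ with $a\le b$ are given. A salary vector $p\in\mathbf{Z}^E$ is feasible if $a_{ij}\le p_{ij}\le b_{ij}$ for all $(i,j)\in E$. For each $(i,j)\in E$ there are two strictly increasing real-valued functions $f_{ij}$ and $f_{ji}$: $f_{ij}(z)$ is the valuation of worker $i$ when working for firm $j$ at salary $z$, and $f_{ji}(-z)$ is the valuation of firm $j$ when hiring $i$ at salary $z$. Salaries are integers; $f_{ji}$ is regarded as a strictly increasing function of a real variable for which the preimages used below exist. A job allocation is $X=\{(S_j,j): j\in F\}$ with $S_j\subseteq W$, $|S_j|\le\mu(j)$ for all $j$, and $S_j\cap S_{j^*}=\emptyset$ for $j\ne j^*$. Write $(i,j)\in X$ if $i\in S_j$; firm $j$ is matched in $X$ if $S_j\neq\emptyset$. Given $X$ and $p$, define $q_i=f_{ij}(p_{ij})$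 if $i\in S_j$ for some $j$, and $q_i=0$ otherwise; define $r_j=\min\{f_{ji}(-p_{ij}): i\in S_j\}$ if $|S_j|=\mu(j)$, and $r_j=0$ otherwise (a minimum over the empty set is $0$). Then $(X;p,q,r)$ with $p$ feasible is called an outcome. Job Allocation Algorithm. STEP[0a]: Put $p_{ij}=b_{ij}$ if $f_{ji}(-b_{ij})\ge0$, and $p_{ij}=\max\{a_{ij},\lfloor -f_{ji}^{-1}(0)\rfloor\}$ otherwise. Put $W_0=\{(i,j)\in E: f_{ij}(p_{ij})<0\}$, $F_0=\{(i,j)\in E: f_{ji}(-p_{ij})<0\}$, $\widetilde E=E\setminus(W_0\cup F_0)$, $\tilde q_i=\max\{f_{ij}(p_{ij}):(i,j)\in\widetilde E\}$ for $i\in W$, $\widetilde E_W=\{(i,j)\in\widetilde E: f_{ij}(p_{ij})=\tilde q_i\}$. Put $X=\emptyset$ (so $r=0$, $q=0$, $\widetilde F=\emptyset$) and $\widehat E_W=\{(i,j)\in\widetilde E_W: f_{ji}(-p_{ij})\ge r_j\}$. Throughout, when a new matching is sought, $\widetilde F$ is the set of firms matched in the current (previous) $X$. STEP[0b]: In the bipartite graph $(W,F;\widehat E_W)$ find a job allocation $X$ (all of whose pairs lie in $\widehat E_W$) such that: (X1) $X$ matches all members of $\widetilde F$; (X2) $X$ minimizes $\sum_{j\in F}\bigl||S_j|-\mu(j)\bigr|$ among those satisfying (X1); (X3) $X$ maximizes $\sum_{(i,j)\in X} f_{ji}(-p_{ij})$ among those satisfying (X1) and (X2). Put $U=\{(i,j)\in\widetilde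 E_W: i\notin S_j\}$ and update $S=(S_j)_{j\in F}$ and $r$ according to $X$ and $p$. STEP[1]: If $U=\emptyset$, define $q$ from $X$ and $p$ and stop, with output $(X;p,q,r)$. Otherwise go to STEP[2]. STEP[2]: For each $(i,j)\in U$ let $m^*_{ij}$ be a positive real number with $f_{ji}(-(p_{ij}-m^*_{ij}))=r_j$ (it is a standing assumption that such a number exists for every $(i,j)\in U$) and let $m_{ij}=\max\{1,\lceil m^*_{ij}\rceil\}$. Put $\tilde p_{ij}=\max\{a_{ij},p_{ij}-m_{ij}\}$ for $(i,j)\in U$ and $\tilde p_{ij}=p_{ij}$ for $(i,j)\in E\setminus U$. Let $L=\{(i,j)\in U: p_{ij}-m_{ij}<a_{ij}\}$ (with $p$ the vector before the update). Replace $p$ by $\tilde p$. STEP[3]: Let $\widetilde W_0=\{(i,j)\in U: f_{ij}(\tilde p_{ij})<0\}$. Replace $W_0$ by $W_0\cup\widetilde W_0$ and $F_0$ by $F_0\cup L$, and update $\widetilde E=E\setminus(W_0\cup F_0)$, then $\tilde q$, $\widetilde E_W$ and $\widehat E_W$ by the formulas of STEP[0a] using the new $p$ and the current $r$. STEP[4]: In $(W,F;\widehat E_W)$ find a job allocation $X$ satisfying (X1)-(X3) as in STEP[0b]; redefine $U$ and update $S$ and $r$. Go to STEP[1]. *)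

theory Defs
  imports Complex_Main
begin

text \<open>
  Workers and firms are finite sets over separate types, so they are disjoint by typing.
  \<open>wval M i j z\<close> is $f_{ij}(z)$ and \<open>fval M j i x\<close> is $f_{ji}(x)$, so that firm \<open>j\<close> values hiring
  \<open>i\<close> at salary \<open>z\<close> by \<open>fval M j i (- z)\<close>. Worker valuations are only ever evaluated at (integer)
  salaries, whereas firm valuations are functions of a real variable because the algorithm uses
  their preimages.
\<close>

record ('w, 'f) market =
  workers :: "'w set"
  firms :: "'f set"
  quota :: "'f \<Rightarrow> nat"
  lower :: "'w \<Rightarrow> 'f \<Rightarrow> int"
  upper :: "'w \<Rightarrow> 'f \<Rightarrow> int"
  wval :: "'w \<Rightarrow> 'f \<Rightarrow> int \<Rightarrow> real"
  fval :: "'f \<Rightarrow> 'w \<Rightarrow> real \<Rightarrow> real"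

type_synonym ('w, 'f) salaries = "'w \<Rightarrow> 'f \<Rightarrow> int"
type_synonym ('w, 'f) allocation = "'f \<Rightarrow> 'w set"

definition pairs :: "('w, 'f) market \<Rightarrow> ('w \<times> 'f) set" where
  "pairs M = workers M \<times> firms M"

text \<open>The last conjunct says that the preimage $f_{ji}^{-1}(0)$ exists where STEP[0a] uses it.\<close>

definition job_market :: "('w, 'f) market \<Rightarrow> bool" where
  "job_market M \<longleftrightarrow>
     finite (workers M) \<and> finite (firms M) \<and>
     (\<forall>j\<in>firms M. 0 < quota M j) \<and>
     (\<forall>(i, j)\<in>pairs M.
        lower M i j \<le> upper M i j \<and>
        strict_mono (wval M i j) \<and> strict_mono (fval M j i) \<and>
        (fval M j i (- real_of_int (upper M i j)) < 0 \<longrightarrow> (\<exists>z. fval M j i z = 0)))"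

definition feasible :: "('w, 'f) market \<Rightarrow> ('w, 'f) salaries \<Rightarrow> bool" where
  "feasible M p \<longleftrightarrow> (\<forall>(i, j)\<in>pairs M. lower M i j \<le> p i j \<and> p i j \<le> upper M i j)"

text \<open>A job allocation $\{(S_j, j) : j \in F\}$ is represented by the family \<open>S\<close>; only its values
  on \<open>firms M\<close> matter.\<close>

definition job_allocation :: "('w, 'f) market \<Rightarrow> ('w, 'f) allocation \<Rightarrow> bool" where
  "job_allocation M S \<longleftrightarrow>
     (\<forall>j\<in>firms M. S j \<subseteq> workers M \<and> card (S j) \<le> quota M j) \<and>
     (\<forall>j\<in>firms M. \<forall>j'\<in>firms M. j \<noteq> j' \<longrightarrow> S j \<inter> S j' = {})"

definition alloc_pairs :: "('w, 'f) market \<Rightarrow> ('w, 'f) allocation \<Rightarrow> ('w \<times> 'f) set" where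
  "alloc_pairs M S = {(i, j). j \<in> firms M \<and> i \<in> S j}"

definition matched_firms :: "('w, 'f) market \<Rightarrow> ('w, 'f) allocation \<Rightarrow> 'f set" where
  "matched_firms M S = {j \<in> firms M. S j \<noteq> {}}"

definition worker_payoff ::
  "('w, 'f) market \<Rightarrow> ('w, 'f) allocation \<Rightarrow> ('w, 'f) salaries \<Rightarrow> 'w \<Rightarrow> real" where
  "worker_payoff M S p i =
     (if \<exists>j\<in>firms M. i \<in> S j
      then let j = (THE j. j \<in> firms M \<and> i \<in> S j) in wval M i j (p i j)
      else 0)"

definition firm_payoff ::
  "('w, 'f) market \<Rightarrow> ('w, 'f) allocation \<Rightarrow> ('w, 'f) salaries \<Rightarrow> 'f \<Rightarrow> real" where
  "firm_payoff M S p j =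
     (if card (S j) = quota M j \<and> S j \<noteq> {}
      then Min ((\<lambda>i. fval M j i (- real_of_int (p i j))) ` S j)
      else 0)"

definition outcome ::
  "('w, 'f) market \<Rightarrow> ('w, 'f) allocation \<Rightarrow> ('w, 'f) salaries \<Rightarrow> ('w \<Rightarrow> real) \<Rightarrow> ('f \<Rightarrow> real) \<Rightarrow> bool"
where
  "outcome M S p q r \<longleftrightarrow>
     job_allocation M S \<and> feasible M p \<and>
     (\<forall>i\<in>workers M. q i = worker_payoff M S p i) \<and>
     (\<forall>j\<in>firms M. r j = firm_payoff M S p j)"

definition pairwise_stable ::
  "('w, 'f) market \<Rightarrow> ('w, 'f) allocation \<Rightarrow> ('w, 'f) salaries \<Rightarrow> ('w \<Rightarrow> real) \<Rightarrow> ('f \<Rightarrow> real) \<Rightarrow> bool"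
where
  "pairwise_stable M S p q r \<longleftrightarrow>
     (\<forall>(i, j)\<in>alloc_pairs M S. 0 \<le> wval M i j (p i j) \<and> 0 \<le> fval M j i (- real_of_int (p i j))) \<and>
     (\<forall>(i, j)\<in>pairs M. \<forall>\<theta>::int. lower M i j \<le> \<theta> \<and> \<theta> \<le> upper M i j \<longrightarrow>
        wval M i j \<theta> \<le> q i \<or> fval M j i (- real_of_int \<theta>) \<le> r j)"


section \<open>The Job Allocation Algorithm\<close>

definition init_salary :: "('w, 'f) market \<Rightarrow> ('w, 'f) salaries" where
  "init_salary M i j =
     (if 0 \<le> fval M j i (- real_of_int (upper M i j)) then upper M i j
      else max (lower M i j) \<lfloor>- inv (fval M j i) 0\<rfloor>)"

text \<open>$\widetilde E$, $\tilde q$, $\widetilde E_W$ and $\widehat E_W$, as functions of the current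
  $p$, $r$, $W_0$ and $F_0$. The maximum $\tilde q_i$ over an empty set is unspecified, but is then
  not used in $\widetilde E_W$.\<close>

definition E_tilde :: "('w, 'f) market \<Rightarrow> ('w \<times> 'f) set \<Rightarrow> ('w \<times> 'f) set \<Rightarrow> ('w \<times> 'f) set" where
  "E_tilde M W0 F0 = pairs M - (W0 \<union> F0)"

definition q_tilde ::
  "('w, 'f) market \<Rightarrow> ('w, 'f) salaries \<Rightarrow> ('w \<times> 'f) set \<Rightarrow> ('w \<times> 'f) set \<Rightarrow> 'w \<Rightarrow> real" where
  "q_tilde M p W0 F0 i = Max {wval M i j (p i j) | j. (i, j) \<in> E_tilde M W0 F0}"

definition E_tilde_W ::
  "('w, 'f) market \<Rightarrow> ('w, 'f) salaries \<Rightarrow> ('w \<times> 'f) set \<Rightarrow> ('w \<times> 'f) set \<Rightarrow> ('w \<times> 'f) set" where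
  "E_tilde_W M p W0 F0 =
     {(i, j) \<in> E_tilde M W0 F0. wval M i j (p i j) = q_tilde M p W0 F0 i}"

definition E_hat_W ::
  "('w, 'f) market \<Rightarrow> ('w, 'f) salaries \<Rightarrow> ('f \<Rightarrow> real) \<Rightarrow> ('w \<times> 'f) set \<Rightarrow> ('w \<times> 'f) set
     \<Rightarrow> ('w \<times> 'f) set" where
  "E_hat_W M p r W0 F0 =
     {(i, j) \<in> E_tilde_W M p W0 F0. r j \<le> fval M j i (- real_of_int (p i j))}"

definition unassigned ::
  "('w, 'f) market \<Rightarrow> ('w, 'f) allocation \<Rightarrow> ('w, 'f) salaries \<Rightarrow> ('w \<times> 'f) set \<Rightarrow> ('w \<times> 'f) set
     \<Rightarrow> ('w \<times> 'f) set" where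
  "unassigned M S p W0 F0 = {(i, j) \<in> E_tilde_W M p W0 F0. i \<notin> S j}"

definition shortfall :: "('w, 'f) market \<Rightarrow> ('w, 'f) allocation \<Rightarrow> int" where
  "shortfall M S = (\<Sum>j\<in>firms M. \<bar>int (card (S j)) - int (quota M j)\<bar>)"

definition firms_value :: "('w, 'f) market \<Rightarrow> ('w, 'f) salaries \<Rightarrow> ('w, 'f) allocation \<Rightarrow> real" where
  "firms_value M p S = (\<Sum>(i, j)\<in>alloc_pairs M S. fval M j i (- real_of_int (p i j)))"

text \<open>\<open>X1\<close>, \<open>X2\<close>, \<open>X3\<close> accumulate: \<open>X3 M p G F' S\<close> says that \<open>S\<close> is a job allocation in the bipartite
  graph with edge set \<open>G\<close> which satisfies all three selection criteria, \<open>F'\<close> being the set of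
  previously matched firms.\<close>

definition X1 ::
  "('w, 'f) market \<Rightarrow> ('w \<times> 'f) set \<Rightarrow> 'f set \<Rightarrow> ('w, 'f) allocation \<Rightarrow> bool" where
  "X1 M G F' S \<longleftrightarrow> job_allocation M S \<and> alloc_pairs M S \<subseteq> G \<and> F' \<subseteq> matched_firms M S"

definition X2 ::
  "('w, 'f) market \<Rightarrow> ('w \<times> 'f) set \<Rightarrow> 'f set \<Rightarrow> ('w, 'f) allocation \<Rightarrow> bool" where
  "X2 M G F' S \<longleftrightarrow> is_arg_min (shortfall M) (X1 M G F') S"

definition X3 ::
  "('w, 'f) market \<Rightarrow> ('w, 'f) salaries \<Rightarrow> ('w \<times> 'f) set \<Rightarrow> 'f set \<Rightarrow> ('w, 'f) allocation \<Rightarrow> bool" where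
  "X3 M p G F' S \<longleftrightarrow> is_arg_max (firms_value M p) (X2 M G F') S"

text \<open>\<open>jaa_state M S p r W0 F0\<close>: some execution of the algorithm arrives at STEP[1] with these current
  values. The algorithm is nondeterministic, since any \<open>S\<close> meeting the selection criteria may be
  picked. An execution passes STEP[2] only if the required numbers $m^*_{ij}$ exist.\<close>

inductive jaa_state ::
  "('w, 'f) market \<Rightarrow> ('w, 'f) allocation \<Rightarrow> ('w, 'f) salaries \<Rightarrow> ('f \<Rightarrow> real)
     \<Rightarrow> ('w \<times> 'f) set \<Rightarrow> ('w \<times> 'f) set \<Rightarrow> bool"
  for M :: "('w, 'f) market"
where
  init:
  "jaa_state M S p (firm_payoff M S p) W0 F0"
  if "p = init_salary M"
    and "W0 = {(i, j) \<in> pairs M. wval M i j (p i j) < 0}"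
    and "F0 = {(i, j) \<in> pairs M. fval M j i (- real_of_int (p i j)) < 0}"
    and "X3 M p (E_hat_W M p (\<lambda>j. 0) W0 F0) (matched_firms M (\<lambda>j. {})) S"
| iterate:
  "jaa_state M S' p' (firm_payoff M S' p') W0' F0'"
  if "jaa_state M S p r W0 F0"
    and "U = unassigned M S p W0 F0"
    and "U \<noteq> {}"
    and "\<forall>(i, j)\<in>U. 0 < mstar i j \<and> fval M j i (- (real_of_int (p i j) - mstar i j)) = r j"
    and "m = (\<lambda>i j. max 1 \<lceil>mstar i j :: real\<rceil>)"
    and "p' = (\<lambda>i j. if (i, j) \<in> U then max (lower M i j) (p i j - m i j) else p i j)"
    and "L = {(i, j) \<in> U. p i j - m i j < lower M i j}"
    and "W0' = W0 \<union> {(i, j) \<in> U. wval M i j (p' i j) < 0}"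
    and "F0' = F0 \<union> L"
    and "X3 M p' (E_hat_W M p' r W0' F0') (matched_firms M S) S'"

definition jaa_output ::
  "('w, 'f) market \<Rightarrow> ('w, 'f) allocation \<Rightarrow> ('w, 'f) salaries \<Rightarrow> ('w \<Rightarrow> real) \<Rightarrow> ('f \<Rightarrow> real) \<Rightarrow> bool"
where
  "jaa_output M S p q r \<longleftrightarrow>
     (\<exists>W0 F0. jaa_state M S p r W0 F0 \<and> unassigned M S p W0 F0 = {}) \<and> q = worker_payoff M S p"

end

theory Submission
  imports Defs
begin

text \<open>
  Salaries only ever fall, and they start so high that a firm profits from none above the initial
  one. A pair \<open>(i, j)\<close> can block the outcome at a salary \<open>\<theta>\<close> only if both sides want it, and there is
  always one that refuses; which one depends on whether \<open>\<theta>\<close> exceeds the current salary.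

  Above the current salary it is the firm that refuses: \<open>fval M j i (- \<theta>) \<le> r j\<close>. A salary cut stops
  exactly where the firm would get its current payoff \<open>r j\<close> (up to rounding down), so every salary
  that is skipped gives it less. When the cut is truncated at the lower bound, this covers all
  salaries of the pair, which then joins \<open>F0\<close>; the pairs in \<open>F0\<close> from the start are those in which
  the firm loses even at the lower bound.
  At or below the current salary it is the worker who refuses: a pair in \<open>W0\<close> is worth less than
  nothing to him, and a pair in \<open>E_tilde\<close> is worth no more than his favourite one, which he holds
  when the algorithm stops.

  The refusals of firms refer to the payoff at the time of the cut, so they persist only if \<open>r\<close>
  never decreases (\<open>firm_payoff_increases\<close>), and this is the crux. Every pair that a firm may use in the
  next round gives it at least \<open>r j\<close>; what has to be shown is that a firm that fills its quota keeps
  doing so, since its payoff would otherwise drop to zero. A worker who is employed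
  has all his other favourites cut in salary, so his employer becomes his only favourite
  (\<open>employer_becomes_only_favourite\<close>). If a full firm came to have a vacancy, one of its former workers would
  be idle, and rehiring him would reduce the total shortfall, against the choice of the new
  allocation (\<open>idle_worker_at_full_firm\<close>).
\<close>

section \<open>Markets, payoffs and favourite pairs\<close>

lemma pairs_iff [simp]: "(i, j) \<in> pairs M \<longleftrightarrow> i \<in> workers M \<and> j \<in> firms M"
  by (simp add: pairs_def)

lemma
  assumes "job_market M" "i \<in> workers M" "j \<in> firms M"
  shows strict_mono_wval: "strict_mono (wval M i j)"
    and strict_mono_fval: "strict_mono (fval M j i)"
    and lower_le_upper: "lower M i j \<le> upper M i j"
  using assms by (fastforce simp: job_market_def)+

lemma feasible_bounds:
  assumes "feasible M p" "i \<in> workers M" "j \<in> firms M"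
  shows "lower M i j \<le> p i j" "p i j \<le> upper M i j"
  using assms by (auto simp: feasible_def pairs_def)

lemma alloc_pairs_iff [simp]: "(i, j) \<in> alloc_pairs M S \<longleftrightarrow> j \<in> firms M \<and> i \<in> S j"
  by (simp add: alloc_pairs_def)

lemma job_allocation_finite:
  assumes "job_market M" "job_allocation M S" "j \<in> firms M"
  shows "finite (S j)"
  using assms by (meson finite_subset job_allocation_def job_market_def)

lemma job_allocation_unique_firm:
  assumes "job_allocation M S" "j \<in> firms M" "j' \<in> firms M" "i \<in> S j" "i \<in> S j'"
  shows "j = j'"
  using assms unfolding job_allocation_def by blast

lemma worker_payoff_employed:
  assumes "job_allocation M S" "j \<in> firms M" "i \<in> S j"
  shows "worker_payoff M S p i = wval M i j (p i j)"
proof -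
  have "(THE j. j \<in> firms M \<and> i \<in> S j) = j"
    using assms job_allocation_unique_firm by (metis (mono_tags, lifting) the_equality)
  then show ?thesis
    using assms by (auto simp: worker_payoff_def)
qed

lemma firm_payoff_nonneg:
  assumes "finite (S j)" "\<And>i. i \<in> S j \<Longrightarrow> 0 \<le> fval M j i (- real_of_int (p i j))"
  shows "0 \<le> firm_payoff M S p j"
  using assms by (auto simp: firm_payoff_def)

lemma firm_payoff_le:
  assumes "finite (S j)" "i \<in> S j" "0 \<le> fval M j i (- real_of_int (p i j))"
  shows "firm_payoff M S p j \<le> fval M j i (- real_of_int (p i j))"
  using assms by (auto simp: firm_payoff_def)

lemma firm_payoff_full_ge:
  assumes "finite (S j)" "card (S j) = quota M j" "0 < quota M j"
    and "\<And>i. i \<in> S j \<Longrightarrow> c \<le> fval M j i (- real_of_int (p i j))"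
  shows "c \<le> firm_payoff M S p j"
  using assms by (auto simp: firm_payoff_def)

lemma finite_wval_row:
  assumes "job_market M"
  shows "finite {wval M i j (p i j) | j. (i, j) \<in> E_tilde M W0 F0}"
proof -
  have "{wval M i j (p i j) | j. (i, j) \<in> E_tilde M W0 F0} \<subseteq> (\<lambda>j. wval M i j (p i j)) ` firms M"
    by (auto simp: E_tilde_def)
  moreover have "finite (firms M)"
    using assms by (simp add: job_market_def)
  ultimately show ?thesis
    by (meson finite_imageI finite_subset)
qed

lemma E_tilde_W_iff:
  assumes "job_market M"
  shows "(i, j) \<in> E_tilde_W M p W0 F0 \<longleftrightarrow>
    (i, j) \<in> E_tilde M W0 F0 \<and>
    (\<forall>j'. (i, j') \<in> E_tilde M W0 F0 \<longrightarrow> wval M i j' (p i j') \<le> wval M i j (p i j))"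
  (is "?l \<longleftrightarrow> ?r")
proof
  assume ?l
  then show ?r
    using finite_wval_row[OF assms]
    by (auto simp: E_tilde_W_def q_tilde_def intro!: Max_ge)
next
  assume ?r
  then have "Max {wval M i j (p i j) | j. (i, j) \<in> E_tilde M W0 F0} = wval M i j (p i j)"
    using finite_wval_row[OF assms] by (intro Max_eqI) auto
  with \<open>?r\<close> show ?l
    by (simp add: E_tilde_W_def q_tilde_def)
qed

lemma favourite_exists:
  assumes "job_market M" "(i, j) \<in> E_tilde M W0 F0"
  obtains j' where "(i, j') \<in> E_tilde_W M p W0 F0"
proof -
  let ?A = "{wval M i j (p i j) | j. (i, j) \<in> E_tilde M W0 F0}"
  have "Max ?A \<in> ?A"
    using finite_wval_row[OF assms(1)] assms(2) by (intro Max_in) auto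
  then show ?thesis
    using that by (auto simp: E_tilde_W_def q_tilde_def)
qed

text \<open>Hiring one more worker keeps all matched firms matched and lowers the shortfall, so after the
  minimization in X2 no idle worker is left that a firm with a vacancy could use.\<close>

lemma idle_worker_at_full_firm:
  assumes M: "job_market M" and S: "X2 M G F' S"
    and G: "(i, j) \<in> G" and i: "i \<in> workers M" and j: "j \<in> firms M"
    and idle: "\<And>k. k \<in> firms M \<Longrightarrow> i \<notin> S k"
  shows "card (S j) = quota M j"
proof (rule ccontr)
  assume "card (S j) \<noteq> quota M j"
  have X1: "X1 M G F' S" and min: "\<And>T. X1 M G F' T \<Longrightarrow> \<not> shortfall M T < shortfall M S"
    using S by (auto simp: X2_def is_arg_min_def)
  then have alloc: "job_allocation M S"
    by (simp add: X1_def)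
  with j \<open>card (S j) \<noteq> quota M j\<close> have vacancy: "card (S j) < quota M j"
    by (auto simp: job_allocation_def order.strict_iff_order)
  define T where "T = S(j := insert i (S j))"
  have card_T: "card (T j) = Suc (card (S j))"
    using idle[OF j] job_allocation_finite[OF M alloc j] by (simp add: T_def)
  have "job_allocation M T"
    using alloc vacancy card_T i idle
    by (auto simp: job_allocation_def T_def)
  moreover have "alloc_pairs M T \<subseteq> G"
    using X1 G by (auto simp: X1_def T_def alloc_pairs_def split: if_splits)
  moreover have "F' \<subseteq> matched_firms M T"
    using X1 by (auto simp: X1_def T_def matched_firms_def)
  ultimately have "X1 M G F' T"
    by (simp add: X1_def)
  moreover have "shortfall M T < shortfall M S"
    unfolding shortfall_def
  proof (rule sum_strict_mono_ex1)
    show "finite (firms M)"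
      using M by (simp add: job_market_def)
    show "\<forall>k\<in>firms M. \<bar>int (card (T k)) - int (quota M k)\<bar> \<le> \<bar>int (card (S k)) - int (quota M k)\<bar>"
      using card_T vacancy by (auto simp: T_def)
    show "\<exists>k\<in>firms M. \<bar>int (card (T k)) - int (quota M k)\<bar> < \<bar>int (card (S k)) - int (quota M k)\<bar>"
      using card_T vacancy j by (intro bexI[of _ j]) auto
  qed
  ultimately show False
    using min by blast
qed

section \<open>An invariant: who refuses which salary\<close>

text \<open>Stability comes from \<open>W0_iff\<close> and the two refusal conditions on firms. The latter compare with
  the current payoff \<open>r\<close>, not with the payoff at the time when the firm refused.\<close>

locale jaa_invariant =
  fixes M :: "('w, 'f) market" and S :: "('w, 'f) allocation" and p :: "('w, 'f) salaries"
    and r :: "'f \<Rightarrow> real" and W0 F0 :: "('w \<times> 'f) set"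
  assumes market: "job_market M"
    and p_feasible: "feasible M p"
    and allocation: "job_allocation M S"
    and employed_favourite: "alloc_pairs M S \<subseteq> E_tilde_W M p W0 F0"
    and r_eq: "r = firm_payoff M S p"
    and W0_iff: "\<And>i j. i \<in> workers M \<Longrightarrow> j \<in> firms M \<Longrightarrow> (i, j) \<in> W0 \<longleftrightarrow> wval M i j (p i j) < 0"
    and firm_accepts: "\<And>i j. i \<in> workers M \<Longrightarrow> j \<in> firms M \<Longrightarrow> (i, j) \<notin> F0 \<Longrightarrow>
      0 \<le> fval M j i (- real_of_int (p i j))"
    and firm_refuses_above: "\<And>i j \<theta>. i \<in> workers M \<Longrightarrow> j \<in> firms M \<Longrightarrow>
      p i j < \<theta> \<Longrightarrow> \<theta> \<le> upper M i j \<Longrightarrow> fval M j i (- real_of_int \<theta>) \<le> r j"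
    and firm_refuses_all: "\<And>i j \<theta>. i \<in> workers M \<Longrightarrow> j \<in> firms M \<Longrightarrow> (i, j) \<in> F0 \<Longrightarrow>
      lower M i j \<le> \<theta> \<Longrightarrow> \<theta> \<le> upper M i j \<Longrightarrow> fval M j i (- real_of_int \<theta>) \<le> r j"
begin

lemma employed:
  assumes "j \<in> firms M" "i \<in> S j"
  shows "i \<in> workers M" "(i, j) \<in> E_tilde_W M p W0 F0"
    "0 \<le> wval M i j (p i j)" "0 \<le> fval M j i (- real_of_int (p i j))"
proof -
  show i: "i \<in> workers M"
    using allocation assms by (auto simp: job_allocation_def)
  show fav: "(i, j) \<in> E_tilde_W M p W0 F0"
    using assms employed_favourite by (auto simp: alloc_pairs_def)
  then have "(i, j) \<notin> W0" "(i, j) \<notin> F0"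
    by (auto simp: E_tilde_W_def E_tilde_def)
  then show "0 \<le> wval M i j (p i j)" "0 \<le> fval M j i (- real_of_int (p i j))"
    using i assms(1) W0_iff[OF i assms(1)] firm_accepts by auto
qed

lemma r_nonneg: "j \<in> firms M \<Longrightarrow> 0 \<le> r j"
  unfolding r_eq using job_allocation_finite[OF market allocation] employed(4)
  by (intro firm_payoff_nonneg)

lemma r_le_employed:
  assumes "j \<in> firms M" "i \<in> S j"
  shows "r j \<le> fval M j i (- real_of_int (p i j))"
  unfolding r_eq
  using assms job_allocation_finite[OF market allocation] employed(4) by (intro firm_payoff_le)

lemma worker_payoff_nonneg: "0 \<le> worker_payoff M S p i"
proof (cases "\<exists>j\<in>firms M. i \<in> S j")
  case True
  then show ?thesis
    using worker_payoff_employed[OF allocation] employed(3) by auto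
qed (simp add: worker_payoff_def)

lemma is_outcome: "outcome M S p (worker_payoff M S p) r"
  using allocation p_feasible r_eq by (simp add: outcome_def)

text \<open>Once no favourite is left unassigned, a worker with an available pair holds his favourite one,
  so he refuses every pair at its current salary or below; the firms refuse above it.\<close>

lemma stable_if_none_unassigned:
  assumes "unassigned M S p W0 F0 = {}"
  shows "pairwise_stable M S p (worker_payoff M S p) r"
proof -
  have "wval M i j \<theta> \<le> worker_payoff M S p i \<or> fval M j i (- real_of_int \<theta>) \<le> r j"
    if i: "i \<in> workers M" and j: "j \<in> firms M" and \<theta>: "lower M i j \<le> \<theta>" "\<theta> \<le> upper M i j"
    for i j \<theta>
  proof (cases "p i j < \<theta> \<or> (i, j) \<in> F0")
    case True
    then show ?thesis
      using firm_refuses_above firm_refuses_all i j \<theta> by blast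
  next
    case False
    have "wval M i j (p i j) \<le> worker_payoff M S p i"
    proof (cases "(i, j) \<in> W0")
      case True
      then show ?thesis
        using W0_iff[OF i j] worker_payoff_nonneg[of i] by simp
    next
      case notW0: False
      then have avail: "(i, j) \<in> E_tilde M W0 F0"
        using False i j by (simp add: E_tilde_def)
      then obtain k where k: "(i, k) \<in> E_tilde_W M p W0 F0"
        using favourite_exists[OF market] by blast
      then have "i \<in> S k" "k \<in> firms M"
        using assms by (auto simp: unassigned_def E_tilde_W_def E_tilde_def)
      then have "worker_payoff M S p i = wval M i k (p i k)"
        using worker_payoff_employed[OF allocation] by blast
      then show ?thesis
        using k avail by (simp add: E_tilde_W_iff[OF market])
    qed
    moreover have "wval M i j \<theta> \<le> wval M i j (p i j)"
      using False strict_mono_wval[OF market i j] by (simp add: strict_mono_less_eq)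
    ultimately show ?thesis
      by linarith
  qed
  then show ?thesis
    using employed unfolding pairwise_stable_def by (fastforce simp del: not_le)
qed

end

section \<open>The initial state\<close>

lemma break_even:
  assumes "job_market M" "i \<in> workers M" "j \<in> firms M"
    and "\<not> 0 \<le> fval M j i (- real_of_int (upper M i j))"
  shows "fval M j i (inv (fval M j i) 0) = 0"
proof -
  have "(i, j) \<in> pairs M"
    using assms by simp
  then have "\<exists>z. fval M j i z = 0"
    using assms unfolding job_market_def by fastforce
  then show ?thesis
    by (metis f_inv_into_f rangeI)
qed

lemma init_salary_feasible:
  assumes M: "job_market M"
  shows "feasible M (init_salary M)"
proof -
  have "lower M i j \<le> init_salary M i j \<and> init_salary M i j \<le> upper M i j"
    if ij: "i \<in> workers M" "j \<in> firms M" for i j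
  proof (cases "0 \<le> fval M j i (- real_of_int (upper M i j))")
    case False
    define z where "z = inv (fval M j i) 0"
    have "fval M j i z = 0"
      unfolding z_def using break_even[OF M ij False] .
    with False have "- real_of_int (upper M i j) < z"
      by (metis not_less strict_mono_less_eq[OF strict_mono_fval[OF M ij]])
    then have "\<lfloor>- z\<rfloor> \<le> upper M i j"
      by linarith
    then show ?thesis
      using False lower_le_upper[OF M ij] by (simp add: init_salary_def z_def)
  qed (use lower_le_upper[OF M ij] in \<open>simp add: init_salary_def\<close>)
  then show ?thesis
    by (auto simp: feasible_def)
qed

text \<open>The initial salary is at least the break-even salary rounded down, so a larger integer
  exceeds the break-even salary itself.\<close>

lemma firm_loses_above_init_salary:
  assumes M: "job_market M" and ij: "i \<in> workers M" "j \<in> firms M"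
    and \<theta>: "init_salary M i j < \<theta>" "\<theta> \<le> upper M i j"
  shows "fval M j i (- real_of_int \<theta>) < 0"
proof -
  have neg: "\<not> 0 \<le> fval M j i (- real_of_int (upper M i j))"
    using \<theta> by (auto simp: init_salary_def)
  define z where "z = inv (fval M j i) 0"
  have z: "fval M j i z = 0"
    unfolding z_def using break_even[OF M ij neg] .
  have "\<lfloor>- z\<rfloor> < \<theta>"
    using neg \<theta> by (simp add: init_salary_def z_def)
  then have "- real_of_int \<theta> < z"
    by linarith
  then show ?thesis
    using z strict_monoD[OF strict_mono_fval[OF M ij]] by metis
qed

lemma jaa_invariant_init:
  assumes M: "job_market M" and p: "p = init_salary M"
    and W0: "W0 = {(i, j) \<in> pairs M. wval M i j (p i j) < 0}"
    and F0: "F0 = {(i, j) \<in> pairs M. fval M j i (- real_of_int (p i j)) < 0}"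
    and S: "X1 M (E_hat_W M p (\<lambda>j. 0) W0 F0) F' S"
  shows "jaa_invariant M S p (firm_payoff M S p) W0 F0"
proof -
  have alloc: "job_allocation M S"
    and sub: "alloc_pairs M S \<subseteq> E_hat_W M p (\<lambda>j. 0) W0 F0"
    using S by (auto simp: X1_def)
  have nonneg: "0 \<le> firm_payoff M S p j" if "j \<in> firms M" for j
  proof (rule firm_payoff_nonneg)
    show "finite (S j)"
      using job_allocation_finite[OF M alloc that] .
    show "0 \<le> fval M j i (- real_of_int (p i j))" if "i \<in> S j" for i
      using sub that \<open>j \<in> firms M\<close> by (auto simp: E_hat_W_def alloc_pairs_def)
  qed
  have above: "fval M j i (- real_of_int \<theta>) < 0"
    if "i \<in> workers M" "j \<in> firms M" "p i j < \<theta>" "\<theta> \<le> upper M i j" for i j \<theta>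
    using firm_loses_above_init_salary[OF M] that p by blast
  show ?thesis
  proof
    show "feasible M p"
      using init_salary_feasible[OF M] p by simp
    show "alloc_pairs M S \<subseteq> E_tilde_W M p W0 F0"
      using sub by (auto simp: E_hat_W_def)
    show "fval M j i (- real_of_int \<theta>) \<le> firm_payoff M S p j"
      if "i \<in> workers M" "j \<in> firms M" "p i j < \<theta>" "\<theta> \<le> upper M i j" for i j \<theta>
      using above[OF that] nonneg[OF that(2)] by linarith
    show "fval M j i (- real_of_int \<theta>) \<le> firm_payoff M S p j"
      if ij: "i \<in> workers M" "j \<in> firms M" and F0': "(i, j) \<in> F0"
        and \<theta>: "lower M i j \<le> \<theta>" "\<theta> \<le> upper M i j" for i j \<theta>
    proof -
      \<comment> \<open>At the break-even salary rounded down the firm would not lose, so it is the lower bound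
        that determines the initial salary.\<close>
      have loss: "fval M j i (- real_of_int (p i j)) < 0"
        using F0' F0 by simp
      have "p i j = lower M i j"
      proof (rule ccontr)
        assume "p i j \<noteq> lower M i j"
        then have neg: "\<not> 0 \<le> fval M j i (- real_of_int (upper M i j))"
          and pz: "p i j = \<lfloor>- inv (fval M j i) 0\<rfloor>"
          using loss p by (auto simp: init_salary_def max_def split: if_splits)
        note z = break_even[OF M ij neg]
        have "inv (fval M j i) 0 \<le> - real_of_int (p i j)"
          unfolding pz by linarith
        then have "0 \<le> fval M j i (- real_of_int (p i j))"
          using z strict_mono_less_eq[OF strict_mono_fval[OF M ij]] by metis
        with loss show False
          by simp
      qed
      then have "fval M j i (- real_of_int \<theta>) < 0"
        using loss above[OF ij] \<theta> by (cases "\<theta> = p i j") auto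
      then show ?thesis
        using nonneg[OF ij(2)] by linarith
    qed
  qed (use M alloc W0 F0 in auto)
qed

section \<open>One round of the algorithm\<close>

locale jaa_round = jaa_invariant M S p r W0 F0
  for M :: "('w, 'f) market" and S p r W0 F0 +
  fixes U L W0' F0' :: "('w \<times> 'f) set" and mstar :: "'w \<Rightarrow> 'f \<Rightarrow> real"
    and m :: "'w \<Rightarrow> 'f \<Rightarrow> int" and p' :: "('w, 'f) salaries" and S' :: "('w, 'f) allocation"
  assumes U_eq: "U = unassigned M S p W0 F0"
    and mstar: "\<forall>(i, j)\<in>U. 0 < mstar i j \<and> fval M j i (- (real_of_int (p i j) - mstar i j)) = r j"
    and m_eq: "m = (\<lambda>i j. max 1 \<lceil>mstar i j\<rceil>)"
    and p'_eq: "p' = (\<lambda>i j. if (i, j) \<in> U then max (lower M i j) (p i j - m i j) else p i j)"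
    and L_eq: "L = {(i, j) \<in> U. p i j - m i j < lower M i j}"
    and W0'_eq: "W0' = W0 \<union> {(i, j) \<in> U. wval M i j (p' i j) < 0}"
    and F0'_eq: "F0' = F0 \<union> L"
    and S': "X2 M (E_hat_W M p' r W0' F0') (matched_firms M S) S'"
begin

lemma U_favourite: "(i, j) \<in> U \<Longrightarrow> (i, j) \<in> E_tilde_W M p W0 F0 \<and> i \<notin> S j"
  by (auto simp: U_eq unassigned_def)

lemma U_available:
  assumes "(i, j) \<in> U"
  shows "i \<in> workers M" "j \<in> firms M" "(i, j) \<notin> W0" "(i, j) \<notin> F0"
  using U_favourite[OF assms] by (auto simp: E_tilde_W_def E_tilde_def)

lemma p'_le:
  assumes "i \<in> workers M" "j \<in> firms M"
  shows "p' i j \<le> p i j"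
  using feasible_bounds[OF p_feasible assms] by (auto simp: p'_eq m_eq)

lemma p'_feasible: "feasible M p'"
proof -
  have "lower M i j \<le> p' i j \<and> p' i j \<le> upper M i j"
    if "i \<in> workers M" "j \<in> firms M" for i j
    using p'_le[OF that] feasible_bounds[OF p_feasible that] by (auto simp: p'_eq)
  then show ?thesis
    by (auto simp: feasible_def)
qed

lemma E_tilde_decreases: "E_tilde M W0' F0' \<subseteq> E_tilde M W0 F0"
  by (auto simp: E_tilde_def W0'_eq F0'_eq)

text \<open>The cut is rounded up by less than one, so an integer salary strictly above the new
  untruncated one still exceeds the salary at which the firm would get exactly \<open>r j\<close>.\<close>

lemma firm_refuses_above_cut:
  assumes "(i, j) \<in> U" "p i j - m i j < \<theta>"
  shows "fval M j i (- real_of_int \<theta>) \<le> r j"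
proof -
  have ms: "0 < mstar i j" "fval M j i (- (real_of_int (p i j) - mstar i j)) = r j"
    using mstar assms(1) by auto
  have "p i j - \<lceil>mstar i j\<rceil> + 1 \<le> \<theta>"
    using assms(2) ms(1) by (simp add: m_eq)
  then have "- real_of_int \<theta> \<le> - (real_of_int (p i j) - mstar i j)"
    by linarith
  then show ?thesis
    using ms(2) strict_mono_less_eq[OF strict_mono_fval[OF market U_available(1,2)[OF assms(1)]]]
    by metis
qed

text \<open>The employer's salary is kept, whereas every other pair tied with it is in \<open>U\<close>: its salary
  drops by at least one, or the pair leaves the market.\<close>

lemma employer_becomes_only_favourite:
  assumes j: "j \<in> firms M" and i: "i \<in> S j"
  shows "(i, j) \<in> E_hat_W M p' r W0' F0'"
    and "(i, k) \<in> E_hat_W M p' r W0' F0' \<Longrightarrow> k = j"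
proof -
  have iw: "i \<in> workers M" and fav: "(i, j) \<in> E_tilde_W M p W0 F0"
    using employed assms by auto
  have notU: "(i, j) \<notin> U"
    using U_favourite i by blast
  then have same: "p' i j = p i j"
    by (simp add: p'_eq)
  have avail: "(i, j) \<in> E_tilde M W0' F0'"
    using fav notU by (auto simp: E_tilde_W_def E_tilde_def W0'_eq F0'_eq L_eq)
  have le: "wval M i k (p' i k) \<le> wval M i k (p i k)" "wval M i k (p i k) \<le> wval M i j (p i j)"
    if "(i, k) \<in> E_tilde M W0' F0'" for k
  proof -
    have k: "(i, k) \<in> E_tilde M W0 F0" "k \<in> firms M"
      using that E_tilde_decreases by (blast, simp add: E_tilde_def)
    show "wval M i k (p' i k) \<le> wval M i k (p i k)"
      using p'_le[OF iw k(2)] strict_mono_wval[OF market iw k(2)] by (simp add: strict_mono_less_eq)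
    show "wval M i k (p i k) \<le> wval M i j (p i j)"
      using fav k(1) by (simp add: E_tilde_W_iff[OF market])
  qed
  then have "(i, j) \<in> E_tilde_W M p' W0' F0'"
    using avail same by (fastforce simp: E_tilde_W_iff[OF market])
  moreover have "r j \<le> fval M j i (- real_of_int (p' i j))"
    using r_le_employed[OF assms] same by simp
  ultimately show "(i, j) \<in> E_hat_W M p' r W0' F0'"
    by (simp add: E_hat_W_def)
  show "k = j" if "(i, k) \<in> E_hat_W M p' r W0' F0'"
  proof (rule ccontr)
    assume "k \<noteq> j"
    have k': "(i, k) \<in> E_tilde M W0' F0'"
      and top: "wval M i j (p i j) \<le> wval M i k (p' i k)"
      using that avail same by (auto simp: E_hat_W_def E_tilde_W_iff[OF market])
    then have k: "k \<in> firms M" "(i, k) \<in> E_tilde M W0 F0"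
      using E_tilde_decreases by (simp add: E_tilde_def, blast)
    have eq: "wval M i k (p i k) = wval M i j (p i j)" "wval M i k (p' i k) = wval M i k (p i k)"
      using le[OF k'] top by linarith+
    then have "(i, k) \<in> E_tilde_W M p W0 F0"
      using fav k(2) by (auto simp: E_tilde_W_iff[OF market])
    moreover have "i \<notin> S k"
      using job_allocation_unique_firm[OF allocation] j k(1) i \<open>k \<noteq> j\<close> by blast
    ultimately have U: "(i, k) \<in> U"
      by (simp add: U_eq unassigned_def)
    moreover have "(i, k) \<notin> L"
      using k' by (simp add: E_tilde_def F0'_eq)
    ultimately have "p' i k < p i k"
      by (auto simp: p'_eq m_eq L_eq)
    then show False
      using eq(2) strict_monoD[OF strict_mono_wval[OF market iw k(1)]] by force
  qed
qed

lemma allocation': "job_allocation M S'"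
  and employed_in_E_hat: "alloc_pairs M S' \<subseteq> E_hat_W M p' r W0' F0'"
  using S' by (auto simp: X2_def is_arg_min_def X1_def)

text \<open>A worker lost by a full firm would be idle, since no other firm is open to him, and hence
  there would be no vacancy after all.\<close>

lemma full_firm_stays_full:
  assumes j: "j \<in> firms M" and full: "card (S j) = quota M j"
  shows "card (S' j) = quota M j"
proof (cases "S j \<subseteq> S' j")
  case True
  then have "quota M j \<le> card (S' j)"
    using card_mono[OF job_allocation_finite[OF market allocation' j]] full by metis
  then show ?thesis
    using allocation' j by (auto simp: job_allocation_def intro: le_antisym)
next
  case False
  then obtain i where i: "i \<in> S j" "i \<notin> S' j"
    by blast
  note only = employer_becomes_only_favourite[OF j i(1)]
  show ?thesis
  proof (rule idle_worker_at_full_firm[OF market S' only(1) _ j])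
    show "i \<in> workers M"
      using employed(1)[OF j i(1)] .
    show "i \<notin> S' k" if "k \<in> firms M" for k
      using only(2) i(2) employed_in_E_hat that by (auto simp: alloc_pairs_def)
  qed
qed

lemma firm_accepts':
  assumes ij: "i \<in> workers M" "j \<in> firms M" and "(i, j) \<notin> F0'"
  shows "0 \<le> fval M j i (- real_of_int (p' i j))"
proof -
  have "0 \<le> fval M j i (- real_of_int (p i j))"
    using firm_accepts[OF ij] assms(3) by (simp add: F0'_eq)
  also have "\<dots> \<le> fval M j i (- real_of_int (p' i j))"
    using p'_le[OF ij] strict_mono_less_eq[OF strict_mono_fval[OF market ij]] by simp
  finally show ?thesis .
qed

lemma firm_payoff_increases:
  assumes j: "j \<in> firms M"
  shows "r j \<le> firm_payoff M S' p' j"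
proof -
  have fin: "finite (S' j)"
    using job_allocation_finite[OF market allocation' j] .
  have hat: "(i, j) \<in> E_hat_W M p' r W0' F0'" if "i \<in> S' j" for i
    using employed_in_E_hat that j by (auto simp: alloc_pairs_def)
  show ?thesis
  proof (cases "card (S j) = quota M j")
    case True
    show ?thesis
    proof (rule firm_payoff_full_ge)
      show "finite (S' j)" "card (S' j) = quota M j"
        using fin full_firm_stays_full[OF j True] .
      show "0 < quota M j"
        using market j by (simp add: job_market_def)
      show "r j \<le> fval M j i (- real_of_int (p' i j))" if "i \<in> S' j" for i
        using hat[OF that] by (simp add: E_hat_W_def)
    qed
  next
    case False
    then have "r j = 0"
      by (simp add: r_eq firm_payoff_def)
    moreover have "0 \<le> firm_payoff M S' p' j"
    proof (rule firm_payoff_nonneg)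
      show "finite (S' j)"
        by (fact fin)
      show "0 \<le> fval M j i (- real_of_int (p' i j))" if "i \<in> S' j" for i
        using hat[OF that] \<open>r j = 0\<close> by (simp add: E_hat_W_def)
    qed
    ultimately show ?thesis
      by simp
  qed
qed

lemma jaa_invariant_round: "jaa_invariant M S' p' (firm_payoff M S' p') W0' F0'"
proof
  show "alloc_pairs M S' \<subseteq> E_tilde_W M p' W0' F0'"
    using employed_in_E_hat by (auto simp: E_hat_W_def)
  show "(i, j) \<in> W0' \<longleftrightarrow> wval M i j (p' i j) < 0" if "i \<in> workers M" "j \<in> firms M" for i j
    using W0_iff[OF that] U_available(3)[of i j] by (auto simp: W0'_eq p'_eq)
  show "fval M j i (- real_of_int \<theta>) \<le> firm_payoff M S' p' j"
    if "i \<in> workers M" "j \<in> firms M" "p' i j < \<theta>" "\<theta> \<le> upper M i j" for i j \<theta>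
  proof -
    have "fval M j i (- real_of_int \<theta>) \<le> r j"
    proof (cases "(i, j) \<in> U")
      case True
      then show ?thesis
        using that(3) by (intro firm_refuses_above_cut) (auto simp: p'_eq)
    next
      case False
      then show ?thesis
        using firm_refuses_above that by (simp add: p'_eq)
    qed
    then show ?thesis
      using firm_payoff_increases[OF that(2)] by linarith
  qed
  show "fval M j i (- real_of_int \<theta>) \<le> firm_payoff M S' p' j"
    if "i \<in> workers M" "j \<in> firms M" "(i, j) \<in> F0'" "lower M i j \<le> \<theta>" "\<theta> \<le> upper M i j"
    for i j \<theta>
  proof -
    have "fval M j i (- real_of_int \<theta>) \<le> r j"
    proof (cases "(i, j) \<in> F0")
      case True
      then show ?thesis
        using firm_refuses_all that by blast
    next
      case False
      then have "(i, j) \<in> U" "p i j - m i j < \<theta>"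
        using that by (auto simp: F0'_eq L_eq)
      then show ?thesis
        by (rule firm_refuses_above_cut)
    qed
    then show ?thesis
      using firm_payoff_increases[OF that(2)] by linarith
  qed
qed (use market p'_feasible allocation' firm_accepts' in auto)

end

section \<open>Stability of the output\<close>

lemma jaa_state_invariant:
  assumes "job_market M" "jaa_state M S p r W0 F0"
  shows "jaa_invariant M S p r W0 F0"
  using assms(2)
proof induction
  case (init p W0 F0 S)
  then show ?case
    using jaa_invariant_init[OF assms(1)] by (auto simp: X3_def X2_def is_arg_min_def is_arg_max_def)
next
  case (iterate S p r W0 F0 U mstar m p' L W0' F0' S')
  interpret jaa_invariant M S p r W0 F0
    by (fact iterate.IH)
  interpret jaa_round M S p r W0 F0 U L W0' F0' mstar m p' S'
    by unfold_locales (use iterate.hyps in \<open>auto simp: X3_def is_arg_max_def\<close>)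
  show ?case
    by (fact jaa_invariant_round)
qed

theorem theorem6p5:
  fixes M :: "('w, 'f) market"
    and S :: "('w, 'f) allocation" and p :: "('w, 'f) salaries"
    and q :: "'w \<Rightarrow> real" and r :: "'f \<Rightarrow> real"
  assumes "job_market M"
    and "jaa_output M S p q r"
  shows "outcome M S p q r \<and> pairwise_stable M S p q r"
proof -
  obtain W0 F0 where state: "jaa_state M S p r W0 F0"
    and stop: "unassigned M S p W0 F0 = {}" and q: "q = worker_payoff M S p"
    using assms(2) by (auto simp: jaa_output_def)
  interpret jaa_invariant M S p r W0 F0
    using jaa_state_invariant[OF assms(1) state] .
  show ?thesis
    using is_outcome stable_if_none_unassigned[OF stop] q by simp
qed

end
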